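(* Let $E$ be an $\mathbf{a}$-dimensional linear space of $\mathbf{b}\times\mathbf{c}$ complex matrices of bounded rank $r$, with basis $E_1,\dots,E_{\mathbf{a}}$, and let $F\subset \operatorname{End}(\mathbb{C}^k)$ be an $\mathbf{a}$-dimensional linear space of pairwise commuting matrices, with basis $F_1,\dots,F_{\mathbf{a}}$. Let $\tilde E$ be the linear space of $\mathbf{b}k\times\mathbf{c}k$ matrices obtained as follows: for each $i$, replace each entry $e$ of $E_i$ by the $k\times k$ block $eF_i$ (i.e., form the Kronecker product $E_i\otimes F_i$), and let $\tilde E$ be the span of the resulting matrices, $\tilde E=\{\sum_{i} t_i\, E_i\otimes F_i : t_i\in\mathbb{C}\}$. Then every element of $\tilde E$ has rank at most $kr$.
   Context: A linear space of $\mathbf{b}\times\mathbf{c}$ matrices is of bounded rank $r$ if the maximal rank of its elements is $r$ and $r<\min\{\mathbf{b},\mathbf{c}\}$. *)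

theory Defs
  imports "HOL-Analysis.Analysis"
begin

text \<open>Complex linear combination of a finite family of matrices indexed by the finite type 'i.\<close>
definition lin_comb :: "('i::finite \<Rightarrow> complex) \<Rightarrow> ('i \<Rightarrow> complex^'c^'b) \<Rightarrow> complex^'c^'b" where
  "lin_comb t M = (\<chi> x y. \<Sum>l\<in>UNIV. t l * M l $ x $ y)"

text \<open>Complex span of the family.\<close>
definition cspan_fam :: "('i::finite \<Rightarrow> complex^'c^'b) \<Rightarrow> (complex^'c^'b) set" where
  "cspan_fam M = {lin_comb t M | t. True}"

text \<open>Linear independence over the complex numbers.\<close>
definition clin_indep_fam :: "('i::finite \<Rightarrow> complex^'c^'b) \<Rightarrow> bool" where
  "clin_indep_fam M \<longleftrightarrow> (\<forall>t. lin_comb t M = 0 \<longrightarrow> (\<forall>l. t l = 0))"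

text \<open>Bounded rank r: maximal rank of elements is r, and r < min b c.\<close>
definition bounded_rank :: "(complex^'c::finite^'b::finite) set \<Rightarrow> nat \<Rightarrow> bool" where
  "bounded_rank S r \<longleftrightarrow> (\<exists>A\<in>S. rank A = r) \<and> (\<forall>A\<in>S. rank A \<le> r) \<and> r < min CARD('b) CARD('c)"

text \<open>Kronecker product: entry e of A is replaced by the block e B.\<close>
definition kron :: "complex^'c^'b \<Rightarrow> complex^'q^'p \<Rightarrow> complex^('c \<times> 'q)^('b \<times> 'p)" where
  "kron A B = (\<chi> ip jq. A $ fst ip $ fst jq * B $ snd ip $ snd jq)"

end

(*
  Pass to transposes, so that rank becomes the dimension of the column space. Let X = \<Sum> y0 i E i
  have the maximal rank r and let H be a generalised inverse, X H X = X. Since X + e Y never has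
  larger rank than X, for every Y in the space
      (I - X H) Y (H Y)^m (I - H X) = 0   for all m:
  for e with I + e H Y invertible this follows from a rank count, and the powers of H Y appear when
  the resolvent (I + e H Y)^-1 is written through the adjugate as a polynomial in e.
  Writing Y = \<Sum> y i E i, these identities are polynomial identities in the y i, so for every
  multiset of indices the corresponding coefficient sum vanishes. As the F i commute, the y i may
  then be replaced by the matrices t i F i: the same identities hold for M = \<Sum> t i E i \<otimes> F i,
  X \<otimes> I and H \<otimes> I. Any M satisfying them has rank at most rank X, by a dimension count on the
  smallest M H-invariant subspace containing M (ker X); and rank (X \<otimes> I) \<le> k r.
*)

theory Submission
  imports Defs "HOL-Computational_Algebra.Polynomial"
begin

section \<open>Column rank\<close>

definition col_rank :: "'a::field^'n^'m \<Rightarrow> nat" where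
  "col_rank A = vec.dim (range ((*v) A))"

lemma range_matrix_mult:
  fixes A :: "'a::field^'n^'m" and B :: "'a^'p^'n"
  shows "range ((*v) (A ** B)) = (*v) A ` range ((*v) B)"
  by (auto simp: matrix_vector_mul_assoc[symmetric] image_comp)

lemma subspace_range_matrix: "vec.subspace (range ((*v) (A::'a::field^'n^'m)))"
  by (rule vec.subspace_image) (rule vec.subspace_UNIV)

lemma col_rank_mult_left: "col_rank (A ** B) \<le> col_rank A"
  for A :: "'a::field^'n^'m" and B :: "'a^'p^'n"
  unfolding col_rank_def range_matrix_mult by (rule vec.dim_subset) auto

lemma col_rank_mult_right: "col_rank (A ** B) \<le> col_rank B"
  for A :: "'a::field^'n^'m" and B :: "'a^'p^'n"
  unfolding col_rank_def range_matrix_mult by (rule vec.dim_image_le) (rule matrix_vector_mul_linear_gen)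

lemma col_rank_add_le: "col_rank (A + B) \<le> col_rank A + col_rank B"
  for A B :: "'a::field^'n^'m"
proof -
  let ?S = "{x + y |x y. x \<in> range ((*v) A) \<and> y \<in> range ((*v) B)}"
  have "range ((*v) (A + B)) \<subseteq> ?S"
    by (auto simp: matrix_vector_mult_add_rdistrib)
  then have "col_rank (A + B) \<le> vec.dim ?S"
    unfolding col_rank_def by (rule vec.dim_subset)
  also have "\<dots> \<le> col_rank A + col_rank B"
    using vec.dim_sums_Int[OF subspace_range_matrix subspace_range_matrix, of A B]
    unfolding col_rank_def by linarith
  finally show ?thesis .
qed

lemma col_rank_mat_1: "col_rank (mat 1 :: 'a::field^'n^'n) = CARD('n)"
  by (simp add: col_rank_def vec_dim_card card_cart_basis)

lemma card_le_col_rank_add_complement: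
  "CARD('n) \<le> col_rank (mat 1 - A) + col_rank (A::'a::field^'n^'n)"
  using col_rank_add_le[of "mat 1 - A" A] by (simp add: col_rank_mat_1)

lemma dim_sums_eq_if_Int_zero:
  fixes S T :: "('a::field^'n) set"
  assumes "vec.subspace S" and "vec.subspace T" and "S \<inter> T \<subseteq> {0}"
  shows "vec.dim {x + y |x y. x \<in> S \<and> y \<in> T} = vec.dim S + vec.dim T"
proof -
  have "S \<inter> T = {0}"
    using assms vec.subspace_0 by blast
  then show ?thesis
    using vec.dim_sums_Int[OF assms(1,2)] by simp
qed

lemma matrix_vector_mult_axis: "A *v axis i 1 = column i (A::'a::field^'n^'m)"
  unfolding column_def matrix_vector_mult_def axis_def
  by (simp add: vec_eq_iff if_distrib if_distribR cong: if_cong)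

lemma span_columns: "vec.span (columns A) = range ((*v) (A::'a::field^'n^'m))"
proof
  show "vec.span (columns A) \<subseteq> range ((*v) A)"
    by (rule vec.span_minimal)
       (auto simp: columns_def matrix_vector_mult_axis[symmetric] subspace_range_matrix)
  show "range ((*v) A) \<subseteq> vec.span (columns A)"
  proof clarify
    fix z
    have "A *v z = (\<Sum>i\<in>UNIV. z $ i *s column i A)" by (rule matrix_mult_sum)
    also have "\<dots> \<in> vec.span (columns A)"
      by (intro vec.span_sum vec.span_scale vec.span_base) (auto simp: columns_def)
    finally show "A *v z \<in> vec.span (columns A)" .
  qed
qed

lemma rank_eq_col_rank_transpose: "rank A = col_rank (transpose (A::'a::field^'n^'m))"
  by (metis col_rank_def row_rank_def_gen rows_transpose span_columns transpose_transpose vec.dim_span)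

text \<open>Extend a basis of \<open>W\<close> to one of \<open>V\<close>: the image of \<open>V\<close> is spanned by that of \<open>W\<close>
  together with the images of the new basis vectors.\<close>

lemma dim_image_codim_le:
  fixes A :: "'a::field^'n^'m"
  assumes "W \<subseteq> V"
  shows "vec.dim ((*v) A ` V) + vec.dim W \<le> vec.dim ((*v) A ` W) + vec.dim V"
proof -
  let ?f = "(*v) A"
  obtain BW where BW: "BW \<subseteq> W" "vec.independent BW" "W \<subseteq> vec.span BW" "card BW = vec.dim W"
    using vec.basis_exists by blast
  obtain B where B: "BW \<subseteq> B" "B \<subseteq> V" "vec.independent B" "V \<subseteq> vec.span B"
    using vec.maximal_independent_subset_extend[of BW V] BW assms by blast
  obtain C where C: "C \<subseteq> ?f ` W" "vec.independent C" "?f ` W \<subseteq> vec.span C"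
      "card C = vec.dim (?f ` W)"
    using vec.basis_exists by blast
  have fin: "finite B" "finite C"
    using B(3) C(2) vec.finiteI_independent by blast+
  have "?f ` BW \<subseteq> vec.span (C \<union> ?f ` (B - BW))"
    using BW(1) C(3) vec.span_mono[of C "C \<union> ?f ` (B - BW)"] by blast
  moreover have "?f ` (B - BW) \<subseteq> vec.span (C \<union> ?f ` (B - BW))"
    by (auto intro: vec.span_base)
  ultimately have "?f ` B \<subseteq> vec.span (C \<union> ?f ` (B - BW))"
    using B(1) by blast
  then have "vec.span (?f ` B) \<subseteq> vec.span (C \<union> ?f ` (B - BW))"
    by (rule vec.span_minimal) (rule vec.subspace_span)
  moreover have "?f ` V \<subseteq> vec.span (?f ` B)"
    using B(4) vec.span_image by blast
  ultimately have "?f ` V \<subseteq> vec.span (C \<union> ?f ` (B - BW))"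
    by blast
  then have "vec.dim (?f ` V) \<le> card (C \<union> ?f ` (B - BW))"
    using fin by (simp add: vec.dim_le_card)
  also have "\<dots> \<le> card C + card (?f ` (B - BW))"
    by (rule card_Un_le)
  also have "\<dots> \<le> card C + card (B - BW)"
    using fin(1) by (simp add: card_image_le)
  also have "card (B - BW) = card B - card BW"
    using B(1) fin(1) by (simp add: card_Diff_subset finite_subset)
  finally have "vec.dim (?f ` V) \<le> card C + (card B - card BW)" .
  moreover have "card BW \<le> card B"
    using B(1) fin(1) by (rule card_mono[rotated])
  moreover have "card B = vec.dim V"
    using vec.basis_card_eq_dim B by blast
  ultimately show ?thesis
    using C(4) BW(4) by linarith
qed

lemma mult_eq_0_if_col_rank_mult_eq:
  fixes A :: "'a::field^'n^'m" and B :: "'a^'p^'n" and C :: "'a^'q^'p"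
  assumes rank_eq: "col_rank (A ** B) = col_rank B" and ABC: "A ** B ** C = 0"
  shows "B ** C = 0"
proof -
  have "B *v (C *v z) = 0" for z
  proof (rule ccontr)
    let ?x = "B *v (C *v z)"
    assume "?x \<noteq> 0"
    have "A *v ?x = (A ** B ** C) *v z"
      by (simp add: matrix_vector_mul_assoc matrix_mul_assoc)
    then have "A *v ?x = 0"
      using ABC by simp
    then have "(*v) A ` vec.span {?x} = vec.span {0}"
      by (metis image_empty image_insert vec.span_image)
    moreover have "vec.span {?x} \<subseteq> range ((*v) B)"
      by (rule vec.span_minimal) (auto intro: subspace_range_matrix)
    ultimately have "vec.dim ((*v) A ` range ((*v) B)) + vec.dim (vec.span {?x})
        \<le> vec.dim (range ((*v) B))"
      using dim_image_codim_le[of "vec.span {?x}" "range ((*v) B)" A] by simp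
    then show False
      using rank_eq \<open>?x \<noteq> 0\<close> by (simp add: col_rank_def range_matrix_mult)
  qed
  then show ?thesis
    by (simp add: matrix_eq matrix_vector_mul_assoc)
qed

lemma ex_generalized_inverse: "\<exists>H :: 'a^'m^'n. X ** H ** X = X"
  for X :: "'a::field^'n^'m"
proof -
  obtain B where B: "B \<subseteq> range ((*v) X)" "vec.independent B" "range ((*v) X) \<subseteq> vec.span B"
    by (meson vec.basis_exists)
  define preimage where "preimage b = (SOME x. X *v x = b)" for b
  have preimage: "X *v preimage b = b" if "b \<in> B" for b
  proof -
    obtain x where "X *v x = b"
      using B(1) \<open>b \<in> B\<close> by blast
    then show ?thesis
      unfolding preimage_def by (rule someI)
  qed
  obtain g where g: "Vector_Spaces.linear (*s) (*s) g" "\<forall>b\<in>B. g b = preimage b"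
    using vec.linear_independent_extend[OF B(2), where f = preimage] by blast
  have XH: "(X ** matrix g) *v w = w" if "w \<in> vec.span B" for w
  proof (rule vec.linear_eq_on_span[OF matrix_vector_mul_linear_gen vec.linear_id _ that,
        unfolded id_def])
    fix b assume "b \<in> B"
    then show "(X ** matrix g) *v b = b"
      by (simp add: matrix_vector_mul_assoc[symmetric] matrix_works[OF g(1)] g(2) preimage)
  qed
  have "(X ** matrix g ** X) *v v = X *v v" for v
  proof -
    have "(X ** matrix g ** X) *v v = (X ** matrix g) *v (X *v v)"
      by (simp only: matrix_vector_mul_assoc)
    also have "\<dots> = X *v v"
      using XH B(3) by blast
    finally show ?thesis .
  qed
  then have "X ** matrix g ** X = X"
    by (intro iffD2[OF matrix_eq] allI)
  then show ?thesis ..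
qed


section \<open>Scaling, sums and word products of matrices\<close>

definition scale_mat :: "'a::times \<Rightarrow> 'a^'n^'m \<Rightarrow> 'a^'n^'m" where
  "scale_mat c A = (\<chi> i j. c * A$i$j)"

lemma scale_mat_mult_left: "scale_mat c (A ** B) = scale_mat c A ** B"
  for A :: "'a::comm_semiring_1^'n^'m"
  by (simp add: scale_mat_def matrix_matrix_mult_def vec_eq_iff sum_distrib_left mult.assoc)

lemma scale_mat_mult_right: "scale_mat c (A ** B) = A ** scale_mat c B"
  for A :: "'a::comm_semiring_1^'n^'m"
  by (simp add: scale_mat_def matrix_matrix_mult_def vec_eq_iff sum_distrib_left mult_ac)

lemma scale_mat_scale_mat: "scale_mat c (scale_mat d A) = scale_mat (c * d) A"
  for A :: "'a::comm_semiring_1^'n^'m"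
  by (simp add: scale_mat_def vec_eq_iff mult.assoc)

lemma scale_mat_0_left [simp]: "scale_mat 0 A = (0::'a::comm_semiring_1^'n^'m)"
  by (simp add: scale_mat_def vec_eq_iff)

lemma scale_mat_0_right [simp]: "scale_mat c 0 = (0::'a::comm_semiring_1^'n^'m)"
  by (simp add: scale_mat_def vec_eq_iff)

lemma scale_mat_1 [simp]: "scale_mat 1 A = (A::'a::comm_semiring_1^'n^'m)"
  by (simp add: scale_mat_def vec_eq_iff)

lemma scale_mat_diff: "scale_mat c (A - B) = scale_mat c A - scale_mat c (B::'a::comm_ring_1^'n^'m)"
  by (simp add: scale_mat_def vec_eq_iff right_diff_distrib)

lemma scale_mat_eq_0_iff: "scale_mat c A = 0 \<longleftrightarrow> c = 0 \<or> A = (0::'a::field^'n^'m)"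
  by (auto simp: scale_mat_def vec_eq_iff)

lemma lin_comb_eq_sum: "lin_comb y E = (\<Sum>i\<in>UNIV. scale_mat (y i) (E i))"
  by (simp add: lin_comb_def scale_mat_def vec_eq_iff)

lemma lin_comb_add_scale_mat:
  "lin_comb y E + scale_mat e (lin_comb z E) = lin_comb (\<lambda>i. y i + e * z i) E"
  by (simp add: lin_comb_def scale_mat_def vec_eq_iff sum.distrib sum_distrib_left
      distrib_right mult.assoc)

lemma matrix_add_rdistrib: "(A + B) ** C = A ** C + B ** (C::'a::comm_semiring_1^'p^'n)"
  by (simp add: matrix_matrix_mult_def vec_eq_iff distrib_right sum.distrib)

lemma matrix_diff_ldistrib: "A ** (B - C) = A ** B - A ** (C::'a::comm_ring_1^'p^'n)"
  by (simp add: matrix_matrix_mult_def vec_eq_iff right_diff_distrib sum_subtractf)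

lemma matrix_diff_rdistrib: "(A - B) ** C = A ** C - B ** (C::'a::comm_ring_1^'p^'n)"
  by (simp add: matrix_matrix_mult_def vec_eq_iff left_diff_distrib sum_subtractf)

lemma matrix_sum_mult_left: "sum f S ** B = (\<Sum>i\<in>S. f i ** (B::'a::comm_semiring_1^'p^'n))"
  by (induction S rule: infinite_finite_induct) (simp_all add: matrix_add_rdistrib)

lemma matrix_sum_mult_right: "A ** sum f S = (\<Sum>i\<in>S. A ** (f i::'a::comm_semiring_1^'p^'n))"
  by (induction S rule: infinite_finite_induct) (simp_all add: matrix_add_ldistrib)

primrec matpow :: "'a::semiring_1^'n^'n \<Rightarrow> nat \<Rightarrow> 'a^'n^'n" where
  "matpow A 0 = mat 1"
| "matpow A (Suc n) = A ** matpow A n"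

lemma matpow_Suc_right: "matpow A (Suc n) = matpow A n ** A"
  by (induction n) (simp_all add: matrix_mul_assoc)

definition word_prod :: "('i \<Rightarrow> 'a::semiring_1^'k^'k) \<Rightarrow> 'i list \<Rightarrow> 'a^'k^'k" where
  "word_prod A w = foldr (\<lambda>i P. A i ** P) w (mat 1)"

lemma word_prod_Nil [simp]: "word_prod A [] = mat 1"
  by (simp add: word_prod_def)

lemma word_prod_Cons [simp]: "word_prod A (i # w) = A i ** word_prod A w"
  by (simp add: word_prod_def)

lemma word_prod_append: "word_prod A (u @ v) = word_prod A u ** word_prod A v"
  by (induction u) (simp_all add: matrix_mul_assoc)

lemma word_prod_commute:
  assumes comm: "\<And>i j. A i ** A j = A j ** A i"
  shows "A i ** word_prod A w = word_prod A w ** A i"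
proof (induction w)
  case (Cons j w)
  have "A i ** (A j ** word_prod A w) = A j ** (A i ** word_prod A w)"
    by (metis comm matrix_mul_assoc)
  also have "\<dots> = (A j ** word_prod A w) ** A i"
    by (simp add: Cons matrix_mul_assoc)
  finally show ?case by simp
qed simp

lemma word_prod_mset_eq:
  assumes comm: "\<And>i j. A i ** A j = A j ** A i"
  shows "mset u = mset v \<Longrightarrow> word_prod A u = word_prod A v"
proof (induction u arbitrary: v)
  case (Cons i u)
  then obtain v1 v2 where v: "v = v1 @ i # v2"
    by (metis list.set_intros(1) set_mset_mset split_list)
  then have "word_prod A u = word_prod A (v1 @ v2)"
    using Cons by simp
  then show ?case
    using word_prod_commute[of A i v1, OF comm]
    by (simp add: v word_prod_append matrix_mul_assoc)
qed simp

lemma word_prod_scale_mat: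
  "word_prod (\<lambda>i. scale_mat (y i) (A i)) w = scale_mat (prod_list (map y w)) (word_prod A w)"
  for A :: "'i \<Rightarrow> 'a::comm_semiring_1^'k^'k"
  by (induction w)
     (simp_all add: scale_mat_mult_left[symmetric] scale_mat_mult_right[symmetric]
       scale_mat_scale_mat mult.commute)

lemma finite_length_lists [simp]: "finite {w :: 'i::finite list. length w = n}"
  using finite_lists_length_eq[of "UNIV :: 'i set" n] by simp

lemma sum_length_Suc_lists:
  "(\<Sum>w | length w = Suc n. f w) = (\<Sum>i\<in>(UNIV :: 'i::finite set). \<Sum>w | length w = n. f (i # w))"
proof -
  have "{w :: 'i list. length w = Suc n} = (\<lambda>(i, w). i # w) ` (UNIV \<times> {w. length w = n})"
    by (auto simp: length_Suc_conv)
  moreover have "inj_on (\<lambda>(i, w). i # w) (UNIV \<times> {w :: 'i list. length w = n})"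
    by (auto simp: inj_on_def)
  ultimately show ?thesis
    by (simp add: sum.reindex sum.cartesian_product case_prod_unfold)
qed

lemma matpow_sum_eq_sum_words:
  fixes P :: "'i::finite \<Rightarrow> 'a::comm_semiring_1^'k^'k"
  shows "matpow (\<Sum>i\<in>UNIV. P i) n = (\<Sum>w | length w = n. word_prod P w)"
proof (induction n)
  case (Suc n)
  then show ?case
    by (simp add: sum_length_Suc_lists matrix_sum_mult_left matrix_sum_mult_right) (rule sum.swap)
qed simp

lemma sandwich_matpow_sum:
  fixes P :: "'i::finite \<Rightarrow> 'a::comm_semiring_1^'n^'m" and Q :: "'i \<Rightarrow> 'a^'n^'n"
  shows "L ** (\<Sum>i\<in>UNIV. P i) ** matpow (\<Sum>i\<in>UNIV. Q i) m ** R
       = (\<Sum>i\<in>UNIV. \<Sum>w | length w = m. L ** P i ** word_prod Q w ** R)"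
  by (simp add: matpow_sum_eq_sum_words matrix_sum_mult_left matrix_sum_mult_right) (rule sum.swap)

lemma sandwich_matpow_sum_scale_mat:
  fixes E :: "'i::finite \<Rightarrow> 'a::comm_semiring_1^'p^'q" and Q :: "'i \<Rightarrow> 'a^'p^'p"
  shows "L ** (\<Sum>i\<in>UNIV. scale_mat (y i) (E i)) ** matpow (\<Sum>i\<in>UNIV. scale_mat (y i) (Q i)) m ** R
       = (\<Sum>w | length w = Suc m.
            scale_mat (prod_list (map y w)) (L ** E (hd w) ** word_prod Q (tl w) ** R))"
  by (simp add: sandwich_matpow_sum sum_length_Suc_lists word_prod_scale_mat scale_mat_scale_mat
      scale_mat_mult_left[symmetric] scale_mat_mult_right[symmetric] mult.commute)


section \<open>Kronecker products\<close>

lemma kron_mult: "kron A B ** kron C D = kron (A ** C) (B ** D)"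
  by (simp add: kron_def matrix_matrix_mult_def vec_eq_iff sum_product
      UNIV_Times_UNIV[symmetric] sum.cartesian_product mult_ac case_prod_unfold
      del: UNIV_Times_UNIV)

lemma kron_mat_1: "kron (mat 1) (mat 1) = mat 1"
  by (auto simp: kron_def mat_def vec_eq_iff prod_eq_iff)

lemma kron_diff_left: "kron (A - B) C = kron A C - kron B C"
  by (simp add: kron_def vec_eq_iff left_diff_distrib)

lemma word_prod_kron:
  "word_prod (\<lambda>i. kron (A i) (B i)) w = kron (word_prod A w) (word_prod B w)"
  by (induction w) (simp_all add: kron_mult kron_mat_1)

lemma sandwich_matpow_sum_kron:
  fixes E :: "'i::finite \<Rightarrow> complex^'p^'q" and Q :: "'i \<Rightarrow> complex^'p^'p"
    and A :: "'i \<Rightarrow> complex^'k^'k"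
  shows "kron L (mat 1) ** (\<Sum>i\<in>UNIV. kron (E i) (A i)) ** matpow (\<Sum>i\<in>UNIV. kron (Q i) (A i)) m
         ** kron R (mat 1)
       = (\<Sum>w | length w = Suc m. kron (L ** E (hd w) ** word_prod Q (tl w) ** R) (word_prod A w))"
  by (simp add: sandwich_matpow_sum sum_length_Suc_lists word_prod_kron kron_mult)

definition tensor_vec :: "'a::times^'m \<Rightarrow> 'a^'n \<Rightarrow> 'a^('m \<times> 'n)" where
  "tensor_vec x y = (\<chi> ij. x $ fst ij * y $ snd ij)"

lemma tensor_vec_in_span:
  fixes S :: "('a::field^'m) set" and T :: "('a^'n) set"
  assumes "finite S" and "finite T" and "x \<in> vec.span S" and "y \<in> vec.span T"
  shows "tensor_vec x y \<in> vec.span ((\<lambda>(a, b). tensor_vec a b) ` (S \<times> T))"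
proof -
  obtain c where x: "x = (\<Sum>a\<in>S. c a *s a)"
    using assms(3) vec.span_finite[OF assms(1)] by auto
  obtain d where y: "y = (\<Sum>b\<in>T. d b *s b)"
    using assms(4) vec.span_finite[OF assms(2)] by auto
  have "tensor_vec x y = (\<Sum>a\<in>S. \<Sum>b\<in>T. (c a * d b) *s tensor_vec a b)"
    by (simp add: x y tensor_vec_def vec_eq_iff sum_product mult_ac)
  also have "\<dots> \<in> vec.span ((\<lambda>(a, b). tensor_vec a b) ` (S \<times> T))"
    by (intro vec.span_sum vec.span_scale vec.span_base) auto
  finally show ?thesis .
qed

lemma col_rank_kron_le:
  fixes A :: "complex^'n^'m" and B :: "complex^'q^'p"
  shows "col_rank (kron A B) \<le> col_rank A * col_rank B"
proof -
  obtain BA where BA: "vec.independent BA" "range ((*v) A) \<subseteq> vec.span BA"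
      "card BA = col_rank A"
    using vec.basis_exists unfolding col_rank_def by blast
  obtain BB where BB: "vec.independent BB" "range ((*v) B) \<subseteq> vec.span BB"
      "card BB = col_rank B"
    using vec.basis_exists unfolding col_rank_def by blast
  have fin: "finite BA" "finite BB"
    using BA(1) BB(1) vec.finiteI_independent by blast+
  let ?S = "(\<lambda>(a, b). tensor_vec a b) ` (BA \<times> BB)"
  have "range ((*v) (kron A B)) \<subseteq> vec.span ?S"
  proof clarify
    fix z
    have "kron A B *v z
        = (\<Sum>ij\<in>UNIV. z $ ij *s tensor_vec (column (fst ij) A) (column (snd ij) B))"
      by (simp add: vec_eq_iff kron_def matrix_vector_mult_def tensor_vec_def column_def mult_ac)
    also have "\<dots> \<in> vec.span ?S"
      using BA(2) BB(2)
      by (intro vec.span_sum vec.span_scale tensor_vec_in_span fin)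
         (auto simp: matrix_vector_mult_axis[symmetric])
    finally show "kron A B *v z \<in> vec.span ?S" .
  qed
  then have "col_rank (kron A B) \<le> card ?S"
    unfolding col_rank_def using fin by (simp add: vec.dim_le_card)
  also have "\<dots> \<le> card (BA \<times> BB)"
    by (intro card_image_le finite_cartesian_product fin)
  finally show ?thesis
    by (simp add: card_cartesian_product BA(3) BB(3))
qed


section \<open>Polynomial identities and commuting substitution\<close>

lemma nat_base_sum_less:
  fixes f :: "nat \<Rightarrow> nat"
  assumes "\<And>j. j < a \<Longrightarrow> f j < B"
  shows "(\<Sum>j<a. f j * B ^ j) < B ^ a"
  using assms
proof (induction a)
  case (Suc a)
  have "(\<Sum>j<a. f j * B ^ j) < B ^ a"
    using Suc.prems by (intro Suc.IH) simp
  then have "(\<Sum>j<Suc a. f j * B ^ j) < Suc (f a) * B ^ a"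
    by simp
  also have "\<dots> \<le> B * B ^ a"
    using Suc.prems[of a] by (intro mult_le_mono1) simp
  finally show ?case
    by simp
qed simp

lemma nat_base_digits_unique:
  fixes c d :: "nat \<Rightarrow> nat"
  assumes "\<And>j. j < a \<Longrightarrow> c j < B" and "\<And>j. j < a \<Longrightarrow> d j < B"
    and "(\<Sum>j<a. c j * B ^ j) = (\<Sum>j<a. d j * B ^ j)"
  shows "\<forall>j<a. c j = d j"
  using assms
proof (induction a)
  case (Suc a)
  let ?Sc = "\<Sum>j<a. c j * B ^ j" and ?Sd = "\<Sum>j<a. d j * B ^ j"
  have "0 < B"
    using Suc.prems(1)[of a] by simp
  have "?Sc < B ^ a" "?Sd < B ^ a"
    using Suc.prems(1,2) by (auto intro: nat_base_sum_less)
  have eq: "?Sc + c a * B ^ a = ?Sd + d a * B ^ a"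
    using Suc.prems(3) by simp
  then have "(?Sc + c a * B ^ a) div B ^ a = (?Sd + d a * B ^ a) div B ^ a"
    by simp
  then have "c a = d a"
    using \<open>?Sc < B ^ a\<close> \<open>?Sd < B ^ a\<close> \<open>0 < B\<close> by simp
  with eq have "?Sc = ?Sd"
    by simp
  with Suc \<open>c a = d a\<close> show ?case
    by (auto simp: less_Suc_eq)
qed simp

text \<open>Kronecker substitution: with \<open>B = n + 1\<close>, the code \<open>\<Sum>x\<leftarrow>w. B ^ idx x\<close> of a word of
  length \<open>n\<close> has the letter counts of \<open>w\<close> as its base-\<open>B\<close> digits.\<close>

lemma kronecker_code_eq_digit_sum:
  fixes idx :: "'i::finite \<Rightarrow> nat"
  assumes idx: "bij_betw idx UNIV {..<CARD('i)}"
  shows "(\<Sum>x\<leftarrow>w. B ^ idx x) = (\<Sum>t<CARD('i). count_list w (inv_into UNIV idx t) * B ^ t)"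
proof -
  have "(\<Sum>x\<leftarrow>w. B ^ idx x) = (\<Sum>x\<in>UNIV. count_list w x * B ^ idx x)"
    unfolding sum_list_map_eq_sum_count
    by (rule sum.mono_neutral_left) (auto simp: count_list_0_iff)
  also have "\<dots> = (\<Sum>t<CARD('i). count_list w (inv_into UNIV idx t) * B ^ idx (inv_into UNIV idx t))"
    using bij_betw_inv_into[OF idx] by (rule sum.reindex_bij_betw[symmetric])
  also have "\<dots> = (\<Sum>t<CARD('i). count_list w (inv_into UNIV idx t) * B ^ t)"
    using idx by (intro sum.cong refl) (simp add: bij_betw_inv_into_right)
  finally show ?thesis .
qed

lemma mset_eq_iff_kronecker_code_eq:
  fixes idx :: "'i::finite \<Rightarrow> nat"
  assumes idx: "bij_betw idx UNIV {..<CARD('i)}"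
    and "length u = n" and "length v = n"
  shows "mset u = mset v \<longleftrightarrow> (\<Sum>x\<leftarrow>u. Suc n ^ idx x) = (\<Sum>x\<leftarrow>v. Suc n ^ idx x)"
proof
  assume "mset u = mset v"
  then have "mset (map (\<lambda>x. Suc n ^ idx x) u) = mset (map (\<lambda>x. Suc n ^ idx x) v)"
    by simp
  then show "(\<Sum>x\<leftarrow>u. Suc n ^ idx x) = (\<Sum>x\<leftarrow>v. Suc n ^ idx x)"
    by (metis sum_mset_sum_list)
next
  assume code_eq: "(\<Sum>x\<leftarrow>u. Suc n ^ idx x) = (\<Sum>x\<leftarrow>v. Suc n ^ idx x)"
  define g where "g = inv_into UNIV idx"
  have digits: "\<forall>t<CARD('i). count_list u (g t) = count_list v (g t)"
  proof (rule nat_base_digits_unique)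
    show "count_list u (g t) < Suc n" if "t < CARD('i)" for t
      using count_le_length[of u "g t"] assms(2) by simp
    show "count_list v (g t) < Suc n" if "t < CARD('i)" for t
      using count_le_length[of v "g t"] assms(3) by simp
    show "(\<Sum>t<CARD('i). count_list u (g t) * Suc n ^ t)
        = (\<Sum>t<CARD('i). count_list v (g t) * Suc n ^ t)"
      using code_eq by (simp add: g_def kronecker_code_eq_digit_sum[OF idx])
  qed
  have "count_list u x = count_list v x" for x
  proof -
    have "idx x < CARD('i)" and "g (idx x) = x"
      using idx unfolding g_def bij_betw_def by (auto simp: inv_into_f_f)
    then show ?thesis
      using digits by metis
  qed
  then show "mset u = mset v"
    by (intro multiset_eqI) (simp add: count_mset)
qed

lemma fibre_sums_eq_0_if_power_sum_eq_0:
  fixes c :: "'w \<Rightarrow> 'a::field_char_0" and e :: "'w \<Rightarrow> nat"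
  assumes "finite W" and "\<And>x. (\<Sum>w\<in>W. x ^ e w * c w) = 0"
  shows "(\<Sum>w | w \<in> W \<and> e w = t. c w) = 0"
proof -
  let ?p = "\<Sum>w\<in>W. monom (c w) (e w)"
  have "?p = 0"
    using assms(2)
    by (intro poly_all_0_iff_0[THEN iffD1] allI) (simp add: poly_sum poly_monom mult.commute)
  moreover have "coeff ?p t = (\<Sum>w | w \<in> W \<and> e w = t. c w)"
    using assms(1) by (simp add: coeff_sum sum.inter_filter)
  ultimately show ?thesis by simp
qed

lemma sum_words_with_mset_eq_0:
  fixes c :: "'i::finite list \<Rightarrow> 'a::field_char_0"
  assumes vanish: "\<And>y. (\<Sum>w | length w = n. prod_list (map y w) * c w) = 0"
  shows "(\<Sum>w | length w = n \<and> mset w = M. c w) = 0"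
proof -
  obtain idx :: "'i \<Rightarrow> nat" where idx: "bij_betw idx UNIV {..<CARD('i)}"
    using ex_bij_betw_finite_nat[of "UNIV :: 'i set"] by (auto simp: atLeast0LessThan)
  define code where "code w = (\<Sum>x\<leftarrow>w. Suc n ^ idx x)" for w :: "'i list"
  have "(\<Sum>w | length w = n. x ^ code w * c w) = 0" for x :: 'a
  proof -
    have "prod_list (map (\<lambda>i. x ^ (Suc n ^ idx i)) w) = x ^ code w" for w
      unfolding code_def by (induction w) (simp_all add: power_add)
    then show ?thesis
      using vanish[of "\<lambda>i. x ^ (Suc n ^ idx i)"] by simp
  qed
  then have fibre: "(\<Sum>w | length w = n \<and> code w = t. c w) = 0" for t
    using fibre_sums_eq_0_if_power_sum_eq_0[of "{w. length w = n}" code c t] by simp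
  show ?thesis
  proof (cases "\<exists>w0. length w0 = n \<and> mset w0 = M")
    case True
    then obtain w0 where w0: "length w0 = n" "mset w0 = M" by blast
    have "{w. length w = n \<and> mset w = M} = {w. length w = n \<and> code w = code w0}"
      using mset_eq_iff_kronecker_code_eq[OF idx _ w0(1)] w0(2) unfolding code_def by auto
    then show ?thesis using fibre by simp
  next
    case False
    then have "{w. length w = n \<and> mset w = M} = {}"
      by blast
    then show ?thesis
      by (simp only: sum.empty)
  qed
qed

text \<open>A polynomial identity in the coefficients \<open>y\<close> survives the substitution of pairwise
  commuting matrices for the \<open>y i\<close>: after grouping words by their multiset of letters, both
  sides only see the (vanishing) sums of coefficients over each group.\<close>

lemma kron_sum_words_eq_0:
  fixes C :: "'i::finite list \<Rightarrow> complex^'p^'q" and A :: "'i \<Rightarrow> complex^'k^'k"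
  assumes comm: "\<And>i j. A i ** A j = A j ** A i"
    and vanish: "\<And>y. (\<Sum>w | length w = n. scale_mat (prod_list (map y w)) (C w)) = 0"
  shows "(\<Sum>w | length w = n. kron (C w) (word_prod A w)) = 0"
proof -
  let ?W = "{w :: 'i list. length w = n}"
  define F where "F M = word_prod A (SOME w. mset w = M)" for M
  have F: "word_prod A w = F (mset w)" for w
    unfolding F_def using someI_ex[OF ex_mset[of "mset w"]] by (intro word_prod_mset_eq[OF comm]) simp
  have "(\<Sum>w\<in>?W. kron (C w) (word_prod A w)) $ (a, p) $ (b, q) = 0" for a b p q
  proof -
    have class_sum: "(\<Sum>w | length w = n \<and> mset w = M. C w $ a $ b) = 0" for M
    proof (rule sum_words_with_mset_eq_0)
      fix y
      have "(\<Sum>w | length w = n. prod_list (map y w) * C w $ a $ b)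
          = (\<Sum>w | length w = n. scale_mat (prod_list (map y w)) (C w)) $ a $ b"
        by (simp add: scale_mat_def)
      then show "(\<Sum>w | length w = n. prod_list (map y w) * C w $ a $ b) = 0"
        by (simp add: vanish)
    qed
    have "(\<Sum>w\<in>?W. kron (C w) (word_prod A w)) $ (a, p) $ (b, q)
        = (\<Sum>w\<in>?W. C w $ a $ b * F (mset w) $ p $ q)"
      by (simp add: kron_def F)
    also have "\<dots> = (\<Sum>M\<in>mset ` ?W. \<Sum>w | w \<in> ?W \<and> mset w = M. C w $ a $ b * F (mset w) $ p $ q)"
      by (rule sum.group[symmetric]) auto
    also have "\<dots> = (\<Sum>M\<in>mset ` ?W. (\<Sum>w | length w = n \<and> mset w = M. C w $ a $ b) * F M $ p $ q)"
      by (intro sum.cong refl) (simp add: sum_distrib_right cong: sum.cong_simp)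
    also have "\<dots> = 0"
      by (simp add: class_sum)
    finally show ?thesis .
  qed
  then show ?thesis
    by (simp add: vec_eq_iff split_paired_All)
qed


section \<open>Polynomial matrices and resolvents\<close>

definition poly_mat_eval :: "'a::comm_semiring_0 \<Rightarrow> 'a poly^'n^'m \<Rightarrow> 'a^'n^'m" where
  "poly_mat_eval x P = (\<chi> i j. poly (P$i$j) x)"

definition const_poly_mat :: "'a::zero^'n^'m \<Rightarrow> 'a poly^'n^'m" where
  "const_poly_mat A = (\<chi> i j. [:A$i$j:])"

definition coeff_mat :: "'a::zero poly^'n^'m \<Rightarrow> nat \<Rightarrow> 'a^'n^'m" where
  "coeff_mat P k = (\<chi> i j. coeff (P$i$j) k)"

definition adjugate :: "'a::comm_ring_1^'n^'n \<Rightarrow> 'a^'n^'n" where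
  "adjugate A = (\<chi> k j. det (\<chi> i l. if l = k then (if i = j then 1 else 0) else A$i$l))"

lemma poly_mat_eval_mult: "poly_mat_eval x (P ** Q) = poly_mat_eval x P ** poly_mat_eval x Q"
  by (simp add: poly_mat_eval_def matrix_matrix_mult_def poly_sum)

lemma poly_mat_eval_add: "poly_mat_eval x (P + Q) = poly_mat_eval x P + poly_mat_eval x Q"
  by (simp add: poly_mat_eval_def vec_eq_iff)

lemma poly_mat_eval_diff:
  "poly_mat_eval x (P - Q) = poly_mat_eval x P - poly_mat_eval x (Q::'a::comm_ring poly^'n^'m)"
  by (simp add: poly_mat_eval_def vec_eq_iff)

lemma poly_mat_eval_scale_mat:
  "poly_mat_eval x (scale_mat p P) = scale_mat (poly p x) (poly_mat_eval x P)"
  by (simp add: poly_mat_eval_def scale_mat_def vec_eq_iff)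

lemma poly_mat_eval_const [simp]: "poly_mat_eval x (const_poly_mat A) = A"
  by (simp add: poly_mat_eval_def const_poly_mat_def vec_eq_iff)

lemma poly_mat_eval_mat_1 [simp]: "poly_mat_eval x (mat 1) = (mat 1::'a::comm_semiring_1^'n^'n)"
  by (simp add: poly_mat_eval_def mat_def vec_eq_iff)

lemma poly_det: "poly (det P) x = det (poly_mat_eval x P)"
  by (simp add: det_def poly_mat_eval_def poly_sum poly_prod)

lemma poly_mat_eval_adjugate: "poly_mat_eval x (adjugate P) = adjugate (poly_mat_eval x P)"
proof -
  have "poly_mat_eval x (adjugate P) $ k $ j = adjugate (poly_mat_eval x P) $ k $ j" for k j
  proof -
    have "poly_mat_eval x (adjugate P) $ k $ j
        = poly (det (\<chi> i l. if l = k then (if i = j then 1 else 0) else P $ i $ l)) x"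
      by (simp add: poly_mat_eval_def adjugate_def)
    also have "\<dots> = det (poly_mat_eval x (\<chi> i l. if l = k then (if i = j then 1 else 0) else P $ i $ l))"
      by (rule poly_det)
    also have "poly_mat_eval x (\<chi> i l. if l = k then (if i = j then 1 else 0) else P $ i $ l)
        = (\<chi> i l. if l = k then (if i = j then 1 else 0) else poly_mat_eval x P $ i $ l)"
      by (simp add: poly_mat_eval_def vec_eq_iff)
    finally show ?thesis
      by (simp add: adjugate_def)
  qed
  then show ?thesis
    by (simp add: vec_eq_iff)
qed

lemma adjugate_eq_scale_mat_inverse:
  fixes A B :: "'a::field^'n^'n"
  assumes "A ** B = mat 1"
  shows "adjugate A = scale_mat (det A) B"
proof -
  have "adjugate A $ k $ j = B $ k $ j * det A" for k j
  proof -
    have "(A *v column j B) $ i = (if i = j then 1 else 0)" for i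
      using assms
      by (simp add: column_def matrix_vector_mult_def matrix_matrix_mult_def vec_eq_iff mat_def)
    then have "(\<chi> i l. if l = k then (A *v column j B) $ i else A $ i $ l)
        = (\<chi> i l. if l = k then (if i = j then 1 else 0) else A $ i $ l)"
      by (simp add: vec_eq_iff)
    then have "adjugate A $ k $ j = det (\<chi> i l. if l = k then (A *v column j B) $ i else A $ i $ l)"
      by (simp add: adjugate_def)
    then show ?thesis
      by (simp add: cramer_lemma column_def)
  qed
  then show ?thesis
    by (simp add: scale_mat_def vec_eq_iff mult.commute)
qed

lemma poly_mat_eq_0_if_eval_eq_0:
  fixes P :: "'a::field_char_0 poly^'n^'m"
  assumes "finite S" and "\<And>x. x \<notin> S \<Longrightarrow> poly_mat_eval x P = 0"
  shows "P = 0"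
proof -
  have "P $ i $ j = 0" for i j
  proof (rule ccontr)
    assume "P $ i $ j \<noteq> 0"
    then have "finite {x. poly (P $ i $ j) x = 0}" by (rule poly_roots_finite)
    moreover have "- S \<subseteq> {x. poly (P $ i $ j) x = 0}"
      using assms(2) by (auto simp: poly_mat_eval_def vec_eq_iff)
    ultimately have "finite (S \<union> - S)"
      using assms(1) finite_subset by blast
    then show False
      using infinite_UNIV_char_0[where 'a = 'a] by simp
  qed
  then show ?thesis by (simp add: vec_eq_iff)
qed

lemma mult_adjugate_poly_mat:
  fixes P :: "'a::field_char_0 poly^'n^'n"
  assumes "det P \<noteq> 0"
  shows "P ** adjugate P = scale_mat (det P) (mat 1)"
proof -
  have "P ** adjugate P - scale_mat (det P) (mat 1) = 0"
  proof (rule poly_mat_eq_0_if_eval_eq_0)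
    show "finite {x. poly (det P) x = 0}" using assms by (rule poly_roots_finite)
    fix x assume "x \<notin> {x. poly (det P) x = 0}"
    then have "invertible (poly_mat_eval x P)"
      by (simp add: invertible_det_nz poly_det)
    then obtain T where T: "poly_mat_eval x P ** T = mat 1"
      unfolding invertible_def by blast
    then show "poly_mat_eval x (P ** adjugate P - scale_mat (det P) (mat 1)) = 0"
      by (simp add: poly_mat_eval_diff poly_mat_eval_mult poly_mat_eval_adjugate
          poly_mat_eval_scale_mat adjugate_eq_scale_mat_inverse poly_det
          scale_mat_mult_right[symmetric])
  qed
  then show ?thesis by simp
qed

lemma coeff_mat_0 [simp]: "coeff_mat 0 k = 0"
  by (simp add: coeff_mat_def vec_eq_iff)

lemma coeff_mat_add: "coeff_mat (P + Q) k = coeff_mat P k + coeff_mat Q k"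
  by (simp add: coeff_mat_def vec_eq_iff)

lemma coeff_mat_const_mult: "coeff_mat (const_poly_mat A ** P) k = A ** coeff_mat P k"
  by (simp add: coeff_mat_def const_poly_mat_def matrix_matrix_mult_def coeff_sum)

lemma coeff_mat_mult_const:
  "coeff_mat (P ** const_poly_mat A) k = coeff_mat P k ** (A::'a::comm_semiring_1^'n^'m)"
  by (simp add: coeff_mat_def const_poly_mat_def matrix_matrix_mult_def coeff_sum mult.commute)

lemma coeff_mat_shift_0: "coeff_mat (scale_mat [:0, 1:] P) 0 = 0"
  by (simp add: coeff_mat_def scale_mat_def vec_eq_iff)

lemma coeff_mat_shift_Suc:
  "coeff_mat (scale_mat [:0, 1:] P) (Suc k) = coeff_mat (P::'a::comm_semiring_1 poly^'n^'m) k"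
  by (simp add: coeff_mat_def scale_mat_def vec_eq_iff)

lemma coeff_mat_scale_mat_1: "coeff_mat (scale_mat d (mat 1)) k = scale_mat (coeff d k) (mat 1)"
  by (simp add: coeff_mat_def scale_mat_def mat_def vec_eq_iff)

text \<open>The \<open>G k\<close> play the role of the coefficients of \<open>(I + x N)\<^sup>-\<^sup>1\<close> multiplied by
  a polynomial \<open>c\<close> with \<open>c 0 = 1\<close>.\<close>

lemma sandwich_matpow_eq_0_if_sandwich_coeffs_eq_0:
  fixes N :: "'a::comm_ring_1^'n^'n" and L :: "'a^'n^'m" and R :: "'a^'p^'n"
  assumes G0: "G 0 = mat 1"
    and G_Suc: "\<And>k. N ** G k = scale_mat (c k) (mat 1) - G (Suc k)"
    and sandwich: "\<And>k. L ** G k ** R = 0"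
  shows "L ** matpow N m ** R = 0"
proof -
  have "L ** matpow N m ** G k ** R = 0" for k
  proof (induction m arbitrary: k)
    case 0
    then show ?case using sandwich by simp
  next
    case (Suc m)
    have "L ** matpow N (Suc m) ** G k ** R = L ** matpow N m ** (N ** G k) ** R"
      by (simp only: matpow_Suc_right matrix_mul_assoc)
    also have "\<dots> = scale_mat (c k) (L ** matpow N m ** G 0 ** R)
        - L ** matpow N m ** G (Suc k) ** R"
      by (simp add: G_Suc G0 matrix_diff_ldistrib matrix_diff_rdistrib
          scale_mat_mult_left[symmetric] scale_mat_mult_right[symmetric])
    also have "\<dots> = 0"
      using Suc.IH by simp
    finally show ?case .
  qed
  from this[of 0] show ?thesis
    using G0 by simp
qed

lemma resolvent_adjugate_coeffs:
  fixes N :: "'a::field_char_0^'n^'n"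
  defines "P \<equiv> mat 1 + scale_mat [:0, 1:] (const_poly_mat N)"
  shows "poly (det P) 0 = 1"
    and "coeff_mat (adjugate P) 0 = mat 1"
    and "N ** coeff_mat (adjugate P) k
           = scale_mat (coeff (det P) (Suc k)) (mat 1) - coeff_mat (adjugate P) (Suc k)"
proof -
  show d0: "poly (det P) 0 = 1"
    by (simp add: P_def poly_det poly_mat_eval_add poly_mat_eval_scale_mat)
  then have adj: "P ** adjugate P = scale_mat (det P) (mat 1)"
    by (intro mult_adjugate_poly_mat) auto
  have P_adj: "P ** adjugate P = adjugate P + scale_mat [:0, 1:] (const_poly_mat N ** adjugate P)"
    by (simp add: P_def matrix_add_rdistrib scale_mat_mult_left[symmetric])
  show "coeff_mat (adjugate P) 0 = mat 1"
    using arg_cong[OF adj, of "\<lambda>Q. coeff_mat Q 0"] d0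
    by (simp add: P_adj coeff_mat_add coeff_mat_shift_0 coeff_mat_scale_mat_1 poly_0_coeff_0)
  have "coeff_mat (adjugate P) (Suc k) + N ** coeff_mat (adjugate P) k
      = scale_mat (coeff (det P) (Suc k)) (mat 1)"
    using arg_cong[OF adj, of "\<lambda>Q. coeff_mat Q (Suc k)"]
    by (simp add: P_adj coeff_mat_add coeff_mat_shift_Suc coeff_mat_const_mult coeff_mat_scale_mat_1)
  then show "N ** coeff_mat (adjugate P) k
      = scale_mat (coeff (det P) (Suc k)) (mat 1) - coeff_mat (adjugate P) (Suc k)"
    by (simp add: eq_diff_eq add.commute)
qed

text \<open>The adjugate of \<open>I + x N\<close> is a polynomial matrix; evaluating it turns the hypothesis into
  the polynomial identity \<open>L adj(I + x N) R = 0\<close>, whose coefficients satisfy the recursion above.\<close>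

lemma sandwich_matpow_eq_0_if_resolvents:
  fixes N :: "'a::field_char_0^'n^'n" and L :: "'a^'n^'m" and R :: "'a^'p^'n"
  assumes resolvent: "\<And>e T. e \<noteq> 0 \<Longrightarrow> (mat 1 + scale_mat e N) ** T = mat 1 \<Longrightarrow> L ** T ** R = 0"
  shows "L ** matpow N m ** R = 0"
proof -
  define P where "P = mat 1 + scale_mat [:0, 1:] (const_poly_mat N)"
  note coeffs = resolvent_adjugate_coeffs[of N, folded P_def]
  have eval_P: "poly_mat_eval x P = mat 1 + scale_mat x N" for x
    by (simp add: P_def poly_mat_eval_add poly_mat_eval_scale_mat)
  have "det P \<noteq> 0"
    using coeffs(1) by auto
  have "const_poly_mat L ** adjugate P ** const_poly_mat R = 0"
  proof (rule poly_mat_eq_0_if_eval_eq_0)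
    show "finite ({0} \<union> {x. poly (det P) x = 0})"
      using \<open>det P \<noteq> 0\<close> by (simp add: poly_roots_finite)
    fix x assume "x \<notin> {0} \<union> {x. poly (det P) x = 0}"
    then have "x \<noteq> 0" and "invertible (mat 1 + scale_mat x N)"
      by (auto simp: invertible_det_nz poly_det eval_P)
    then obtain T where T: "(mat 1 + scale_mat x N) ** T = mat 1"
      unfolding invertible_def by blast
    have "poly_mat_eval x (adjugate P) = scale_mat (poly (det P) x) T"
      by (simp add: poly_mat_eval_adjugate eval_P adjugate_eq_scale_mat_inverse[OF T] poly_det)
    then show "poly_mat_eval x (const_poly_mat L ** adjugate P ** const_poly_mat R) = 0"
      using resolvent[OF \<open>x \<noteq> 0\<close> T]
      by (simp add: poly_mat_eval_mult scale_mat_mult_left[symmetric] scale_mat_mult_right[symmetric])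
  qed
  then have "L ** coeff_mat (adjugate P) k ** R = 0" for k
    using coeff_mat_mult_const[of "const_poly_mat L ** adjugate P" R k]
    by (simp add: coeff_mat_const_mult)
  then show ?thesis
    by (rule sandwich_matpow_eq_0_if_sandwich_coeffs_eq_0[OF coeffs(2,3)])
qed


section \<open>Perturbations of a matrix of maximal rank\<close>

lemma sandwich_resolvent_eq_0_if_max_rank:
  fixes X Y :: "'a::field^'p^'q" and H :: "'a^'q^'p"
  assumes XHX: "X ** H ** X = X"
    and rank: "col_rank (X + scale_mat e Y) \<le> col_rank X"
    and T: "(mat 1 + scale_mat e (H ** Y)) ** T = mat 1" and "e \<noteq> 0"
  shows "(mat 1 - X ** H) ** Y ** T ** (mat 1 - H ** X) = 0"
proof -
  define G where "G = (X + scale_mat e Y) ** T"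
  have "X ** H ** (X + scale_mat e Y) = X ** (mat 1 + scale_mat e (H ** Y))"
    by (simp add: matrix_add_ldistrib scale_mat_mult_right XHX matrix_mul_assoc)
  then have XHG: "X ** H ** G = X"
    by (metis G_def T matrix_mul_assoc matrix_mul_rid)
  have "col_rank X \<le> col_rank G"
    using col_rank_mult_right[of "X ** H" G] XHG by simp
  moreover have "col_rank G \<le> col_rank X"
    using col_rank_mult_left[of "X + scale_mat e Y" T] rank unfolding G_def by linarith
  ultimately have "col_rank (X ** H ** G) = col_rank G"
    using XHG by simp
  moreover have "X ** H ** G ** (mat 1 - H ** X) = 0"
    by (simp add: XHG matrix_diff_ldistrib matrix_mul_assoc XHX)
  ultimately have GR: "G ** (mat 1 - H ** X) = 0"
    by (rule mult_eq_0_if_col_rank_mult_eq)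
  have LX: "(mat 1 - X ** H) ** (X + scale_mat e Y) = scale_mat e ((mat 1 - X ** H) ** Y)"
    by (simp add: matrix_add_ldistrib matrix_diff_rdistrib XHX scale_mat_mult_right scale_mat_diff)
  have "scale_mat e ((mat 1 - X ** H) ** Y ** T ** (mat 1 - H ** X))
      = (mat 1 - X ** H) ** (G ** (mat 1 - H ** X))"
    by (simp add: G_def matrix_mul_assoc LX scale_mat_mult_left)
  also have "\<dots> = 0"
    unfolding GR by (simp add: matrix_matrix_mult_def vec_eq_iff)
  finally show ?thesis
    using \<open>e \<noteq> 0\<close> by (simp add: scale_mat_eq_0_iff)
qed

lemma sandwich_matpow_eq_0_if_max_rank:
  fixes X Y :: "'a::field_char_0^'p^'q" and H :: "'a^'q^'p"
  assumes "X ** H ** X = X" and "\<And>e. col_rank (X + scale_mat e Y) \<le> col_rank X"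
  shows "(mat 1 - X ** H) ** Y ** matpow (H ** Y) m ** (mat 1 - H ** X) = 0"
proof (rule sandwich_matpow_eq_0_if_resolvents)
  fix e T assume "e \<noteq> 0" and "(mat 1 + scale_mat e (H ** Y)) ** T = mat 1"
  then show "(mat 1 - X ** H) ** Y ** T ** (mat 1 - H ** X) = 0"
    using sandwich_resolvent_eq_0_if_max_rank[OF assms] by blast
qed

lemma sandwich_words_eq_0_if_max_rank:
  fixes E :: "'i::finite \<Rightarrow> complex^'p^'q" and H :: "complex^'q^'p"
  assumes X: "X = lin_comb y0 E"
    and max_rank: "\<And>y. col_rank (lin_comb y E) \<le> col_rank X"
    and XHX: "X ** H ** X = X"
  shows "(\<Sum>w | length w = Suc m. scale_mat (prod_list (map y w))
           ((mat 1 - X ** H) ** E (hd w) ** word_prod (\<lambda>i. H ** E i) (tl w) ** (mat 1 - H ** X))) = 0"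
proof -
  have "col_rank (X + scale_mat e (lin_comb y E)) \<le> col_rank X" for e
    using max_rank by (simp add: X lin_comb_add_scale_mat)
  then have "0 = (mat 1 - X ** H) ** lin_comb y E ** matpow (H ** lin_comb y E) m ** (mat 1 - H ** X)"
    by (rule sandwich_matpow_eq_0_if_max_rank[OF XHX, symmetric])
  also have "\<dots> = (mat 1 - X ** H) ** (\<Sum>i\<in>UNIV. scale_mat (y i) (E i))
      ** matpow (\<Sum>i\<in>UNIV. scale_mat (y i) (H ** E i)) m ** (mat 1 - H ** X)"
    by (simp add: lin_comb_eq_sum matrix_sum_mult_right scale_mat_mult_right)
  also have "\<dots> = (\<Sum>w | length w = Suc m. scale_mat (prod_list (map y w))
      ((mat 1 - X ** H) ** E (hd w) ** word_prod (\<lambda>i. H ** E i) (tl w) ** (mat 1 - H ** X)))"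
    by (rule sandwich_matpow_sum_scale_mat)
  finally show ?thesis
    by (rule sym)
qed


section \<open>A rank bound from the sandwich identities\<close>

lemma dim_range_complement_plus_image:
  fixes X :: "'a::field^'p^'q" and H :: "'a^'q^'p"
  assumes XHX: "X ** H ** X = X"
    and "vec.subspace U"
    and U_fixed: "\<And>u. u \<in> U \<Longrightarrow> X *v (H *v u) = u"
  shows "vec.dim {x + y |x y. x \<in> range ((*v) (mat 1 - H ** X)) \<and> y \<in> (*v) H ` U}
       = vec.dim (range ((*v) (mat 1 - H ** X))) + vec.dim U"
proof -
  let ?K = "range ((*v) (mat 1 - H ** X))"
  have "X ** (mat 1 - H ** X) = 0"
    by (simp add: matrix_diff_ldistrib matrix_mul_assoc XHX)
  have "?K \<inter> (*v) H ` U \<subseteq> {0}"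
  proof
    fix x assume "x \<in> ?K \<inter> (*v) H ` U"
    then obtain z u where x: "x = (mat 1 - H ** X) *v z" "x = H *v u" and "u \<in> U"
      by blast
    have "x = H *v (X *v x)"
      using U_fixed[OF \<open>u \<in> U\<close>] by (simp add: x(2))
    also have "X *v x = 0"
      using \<open>X ** (mat 1 - H ** X) = 0\<close> by (simp add: x(1) matrix_vector_mul_assoc)
    finally show "x \<in> {0}"
      by simp
  qed
  moreover have "vec.dim ((*v) H ` U) = vec.dim U"
  proof -
    have "vec.span U = U"
      using \<open>vec.subspace U\<close> by simp
    moreover have "inj_on ((*v) H) U"
      by (rule inj_onI) (metis U_fixed)
    ultimately show ?thesis
      by (metis vec.dim_image_eq[OF matrix_vector_mul_linear_gen])
  qed
  ultimately show ?thesis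
    using \<open>vec.subspace U\<close>
    by (simp add: dim_sums_eq_if_Int_zero subspace_range_matrix vec.subspace_image)
qed

text \<open>Here \<open>I - H X\<close> maps onto the kernel of \<open>X\<close>, and \<open>U\<close> lies in the range of \<open>X\<close>, on which
  \<open>X H\<close> is the identity. The space \<open>W = range (I - H X) + H U\<close> is a direct sum of dimension
  at least \<open>n - rank X + dim U\<close> that \<open>M\<close> maps into \<open>U\<close>.\<close>

lemma col_rank_le_if_invariant_subspace:
  fixes M X :: "'a::field^'p^'q" and H :: "'a^'q^'p"
  assumes XHX: "X ** H ** X = X"
    and "vec.subspace U"
    and U_fixed: "\<And>u. u \<in> U \<Longrightarrow> X *v (H *v u) = u"
    and U_ker: "\<And>z. M *v ((mat 1 - H ** X) *v z) \<in> U"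
    and U_inv: "\<And>u. u \<in> U \<Longrightarrow> M *v (H *v u) \<in> U"
  shows "col_rank M \<le> col_rank X"
proof -
  define K where "K = range ((*v) (mat 1 - H ** X))"
  define W where "W = {x + y |x y. x \<in> K \<and> y \<in> (*v) H ` U}"
  have dim_W: "vec.dim W = vec.dim K + vec.dim U"
    unfolding W_def K_def by (rule dim_range_complement_plus_image[OF XHX \<open>vec.subspace U\<close> U_fixed])
  have "(*v) M ` W \<subseteq> U"
  proof
    fix v assume "v \<in> (*v) M ` W"
    then obtain z u where v: "v = M *v ((mat 1 - H ** X) *v z + H *v u)" and "u \<in> U"
      unfolding W_def K_def by blast
    then show "v \<in> U"
      using U_ker[of z] U_inv[OF \<open>u \<in> U\<close>] vec.subspace_add[OF \<open>vec.subspace U\<close>]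
      by (simp add: matrix_vector_right_distrib)
  qed
  then have "vec.dim ((*v) M ` W) \<le> vec.dim U"
    by (rule vec.dim_subset)
  then have "col_rank M + vec.dim W \<le> vec.dim U + CARD('p)"
    using dim_image_codim_le[of W UNIV M, OF subset_UNIV]
    unfolding col_rank_def vec_dim_card by linarith
  moreover have "CARD('p) \<le> vec.dim K + col_rank X"
    using card_le_col_rank_add_complement[of "H ** X"] col_rank_mult_right[of H X]
    unfolding K_def col_rank_def by linarith
  ultimately show ?thesis
    using dim_W by linarith
qed

text \<open>The span of \<open>G\<close> below is the smallest \<open>M H\<close>-invariant subspace containing \<open>M (ker X)\<close>.\<close>

lemma col_rank_le_if_sandwich_matpow_eq_0:
  fixes M X :: "'a::field^'p^'q" and H :: "'a^'q^'p"
  assumes XHX: "X ** H ** X = X"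
    and sandwich: "\<And>m. (mat 1 - X ** H) ** M ** matpow (H ** M) m ** (mat 1 - H ** X) = 0"
  shows "col_rank M \<le> col_rank X"
proof -
  define G where "G = {(M ** matpow (H ** M) m ** (mat 1 - H ** X)) *v z | m z. True}"
  have "G \<subseteq> {u. (mat 1 - X ** H) *v u = 0}"
    unfolding G_def
  proof clarify
    fix m z
    have "(mat 1 - X ** H) *v ((M ** matpow (H ** M) m ** (mat 1 - H ** X)) *v z)
        = ((mat 1 - X ** H) ** M ** matpow (H ** M) m ** (mat 1 - H ** X)) *v z"
      by (simp only: matrix_vector_mul_assoc matrix_mul_assoc)
    then show "(mat 1 - X ** H) *v ((M ** matpow (H ** M) m ** (mat 1 - H ** X)) *v z) = 0"
      by (simp add: sandwich)
  qed
  then have "vec.span G \<subseteq> {u. (mat 1 - X ** H) *v u = 0}"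
    by (intro vec.span_minimal vec.subspace_kernel)
  then have fixed: "X *v (H *v u) = u" if "u \<in> vec.span G" for u
    using that by (auto simp: matrix_vector_mult_diff_rdistrib matrix_vector_mul_assoc)
  have ker: "M *v ((mat 1 - H ** X) *v z) \<in> vec.span G" for z
  proof (rule vec.span_base)
    have "M *v ((mat 1 - H ** X) *v z) = (M ** matpow (H ** M) 0 ** (mat 1 - H ** X)) *v z"
      by (simp add: matrix_vector_mul_assoc)
    then show "M *v ((mat 1 - H ** X) *v z) \<in> G"
      unfolding G_def by blast
  qed
  have "(*v) (M ** H) ` G \<subseteq> G"
  proof
    fix y assume "y \<in> (*v) (M ** H) ` G"
    then obtain m z where "y = (M ** H) *v ((M ** matpow (H ** M) m ** (mat 1 - H ** X)) *v z)"
      unfolding G_def by blast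
    also have "\<dots> = (M ** matpow (H ** M) (Suc m) ** (mat 1 - H ** X)) *v z"
      by (simp add: matrix_vector_mul_assoc matrix_mul_assoc)
    finally show "y \<in> G"
      unfolding G_def by blast
  qed
  then have "vec.span ((*v) (M ** H) ` G) \<subseteq> vec.span G"
    by (rule vec.span_mono)
  then have inv: "M *v (H *v u) \<in> vec.span G" if "u \<in> vec.span G" for u
    using that unfolding vec.span_image by (auto simp: matrix_vector_mul_assoc)
  show ?thesis
    by (rule col_rank_le_if_invariant_subspace[OF XHX vec.subspace_span fixed ker inv])
qed


section \<open>The rank bound for sums of Kronecker products\<close>

lemma col_rank_kron_sum_le:
  fixes E :: "'i::finite \<Rightarrow> complex^'p^'q" and A :: "'i \<Rightarrow> complex^'k^'k"
  assumes max_rank: "\<And>y. col_rank (lin_comb y E) \<le> col_rank (lin_comb y0 E)"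
    and comm: "\<And>i j. A i ** A j = A j ** A i"
  shows "col_rank (\<Sum>i\<in>UNIV. kron (E i) (A i)) \<le> CARD('k) * col_rank (lin_comb y0 E)"
proof -
  define X where "X = lin_comb y0 E"
  obtain H where XHX: "X ** H ** X = X"
    using ex_generalized_inverse by blast
  have max_rank_X: "col_rank (lin_comb y E) \<le> col_rank X" for y
    using max_rank by (simp add: X_def)
  define XX where "XX = kron X (mat 1 :: complex^'k^'k)"
  define HH where "HH = kron H (mat 1 :: complex^'k^'k)"
  have "col_rank (\<Sum>i\<in>UNIV. kron (E i) (A i)) \<le> col_rank XX"
  proof (rule col_rank_le_if_sandwich_matpow_eq_0)
    show "XX ** HH ** XX = XX"
      by (simp add: XX_def HH_def kron_mult XHX)
    have "mat 1 - XX ** HH = kron (mat 1 - X ** H) (mat 1)"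
      and "mat 1 - HH ** XX = kron (mat 1 - H ** X) (mat 1)"
      by (simp_all add: XX_def HH_def kron_mult kron_diff_left kron_mat_1)
    moreover have "HH ** (\<Sum>i\<in>UNIV. kron (E i) (A i)) = (\<Sum>i\<in>UNIV. kron (H ** E i) (A i))"
      by (simp add: HH_def matrix_sum_mult_right kron_mult)
    moreover note kron_sum_words_eq_0[OF comm sandwich_words_eq_0_if_max_rank[OF X_def max_rank_X XHX]]
    ultimately show "(mat 1 - XX ** HH) ** (\<Sum>i\<in>UNIV. kron (E i) (A i))
        ** matpow (HH ** (\<Sum>i\<in>UNIV. kron (E i) (A i))) m ** (mat 1 - HH ** XX) = 0" for m
      by (simp add: sandwich_matpow_sum_kron)
  qed
  also have "\<dots> \<le> CARD('k) * col_rank X"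
    using col_rank_kron_le[of X "mat 1 :: complex^'k^'k"] by (simp add: XX_def col_rank_mat_1 mult.commute)
  finally show ?thesis
    by (simp add: X_def)
qed

lemma transpose_lin_comb: "transpose (lin_comb y E) = lin_comb y (\<lambda>l. transpose (E l))"
  by (simp add: lin_comb_def transpose_def vec_eq_iff)

lemma transpose_lin_comb_kron:
  "transpose (lin_comb t (\<lambda>l. kron (E l) (F l)))
     = (\<Sum>l\<in>UNIV. kron (transpose (E l)) (scale_mat (t l) (transpose (F l))))"
  by (simp add: vec_eq_iff lin_comb_def kron_def transpose_def scale_mat_def mult_ac)

lemma mem_cspan_fam: "F i \<in> cspan_fam F"
proof -
  have "lin_comb (\<lambda>l. if l = i then 1 else 0) F = F i"
    by (simp add: lin_comb_def vec_eq_iff if_distrib if_distribR cong: if_cong)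
  then show ?thesis
    unfolding cspan_fam_def by (intro CollectI exI[of _ "\<lambda>l. if l = i then 1 else 0"]) simp
qed

lemma scale_mat_transpose_commute:
  fixes A B :: "'a::comm_semiring_1^'n^'n"
  assumes "A ** B = B ** A"
  shows "scale_mat a (transpose A) ** scale_mat b (transpose B)
       = scale_mat b (transpose B) ** scale_mat a (transpose A)"
  using assms
  by (simp add: scale_mat_mult_left[symmetric] scale_mat_mult_right[symmetric] scale_mat_scale_mat
      matrix_transpose_mul[symmetric] mult.commute)

theorem mainTheorem2:
  fixes E :: "'i::finite \<Rightarrow> complex^'c::finite^'b::finite"
    and F :: "'i \<Rightarrow> complex^'k::finite^'k"
    and r :: nat
  assumes E_basis: "clin_indep_fam E"
    and E_bounded: "bounded_rank (cspan_fam E) r"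
    and F_basis: "clin_indep_fam F"
    and F_comm: "\<forall>X\<in>cspan_fam F. \<forall>Y\<in>cspan_fam F. X ** Y = Y ** X"
  shows "\<forall>M\<in>cspan_fam (\<lambda>l. kron (E l) (F l)). rank M \<le> CARD('k) * r"
proof
  fix M assume "M \<in> cspan_fam (\<lambda>l. kron (E l) (F l))"
  then obtain t where M: "M = lin_comb t (\<lambda>l. kron (E l) (F l))"
    by (auto simp: cspan_fam_def)
  obtain y0 where y0: "rank (lin_comb y0 E) = r" and bound: "\<And>y. rank (lin_comb y E) \<le> r"
    using E_bounded unfolding bounded_rank_def cspan_fam_def by blast
  let ?E = "\<lambda>l. transpose (E l)" and ?A = "\<lambda>l. scale_mat (t l) (transpose (F l))"
  have "?A i ** ?A j = ?A j ** ?A i" for i j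
    using F_comm mem_cspan_fam[of F] by (intro scale_mat_transpose_commute) blast
  moreover have "col_rank (lin_comb y ?E) \<le> col_rank (lin_comb y0 ?E)" for y
    using bound[of y] y0 by (simp add: rank_eq_col_rank_transpose transpose_lin_comb)
  ultimately have "col_rank (\<Sum>l\<in>UNIV. kron (?E l) (?A l)) \<le> CARD('k) * col_rank (lin_comb y0 ?E)"
    by (intro col_rank_kron_sum_le)
  then show "rank M \<le> CARD('k) * r"
    using y0 by (simp add: M rank_eq_col_rank_transpose transpose_lin_comb_kron transpose_lin_comb)
qed

end
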